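(* Let $\varepsilon>0$ and a positive integer $n$ be fixed, and let $p$ be a sufficiently large prime. Assume that a real number $\Delta\ge1$ and an integer $h$ with $p/2>h\ge1$ satisfy $$h^{n-1}\le\Delta p^{-\varepsilon}\qquad\text{and}\qquad \Delta<p^{1-\varepsilon}.$$ Let $f\in\mathbb{F}_p[X]$ be a polynomial of degree at most $n$. Then for every real $\rho\le 1$ with $$\rho\ge\max\{\Delta p^{-1},\ h^{-1/2^{n-1}}\}\,p^{\varepsilon}$$ we have $$\#\mathcal{M}_f(\rho,h,\Delta)\ll \rho^{-2^{n-1}-n(n^2+1)/2}\,\Delta^{n+1}\,h^{(n^2-n+2)/2}\,p^{o(1)}.$$
   Context: Elements of $\mathbb{F}_p$ are identified with $\{0,\ldots,p-1\}$. For integers $s$ and $m\ge1$, $|s|_m=\min_{j\in\mathbb{Z}}|s-jm|$. For $f\in\mathbb{F}_p[X]$ and real $0<\rho\le1$, $\mathcal{M}_f(\rho,h,\Delta)$ is the set of polynomials $\tilde f\in\mathbb{F}_p[X]$ of degree at most $n$ such that $|\tilde f(t)-f(t)|_p\le\Delta$ for at least $\rho(2h+1)$ integers $t\in[-h,h]$. The implied constant in $\ll$ depends only on $n$ and $\varepsilon$, and $p^{o(1)}$ denotes a factor $p^{\epsilon(p)}$ with $\epsilon(p)\to0$ as $p\to\infty$. *)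

theory Defs
  imports Complex_Main "HOL-Number_Theory.Residues" "HOL-Algebra.Polynomials"
begin

text \<open>The field with \<open>p\<close> elements is \<open>residue_ring (int p)\<close>, whose carrier is \<open>{0..int p - 1}\<close>.
  Its univariate polynomials are coefficient lists, highest coefficient first, with nonzero head.\<close>

abbreviation Fp :: "nat \<Rightarrow> int ring" where
  "Fp p \<equiv> residue_ring (int p)"

abbreviation Fp_poly :: "nat \<Rightarrow> int list ring" where
  "Fp_poly p \<equiv> univ_poly (Fp p) (carrier (Fp p))"

definition Fp_eval :: "nat \<Rightarrow> int list \<Rightarrow> int \<Rightarrow> int" where
  "Fp_eval p f t = ring.eval (Fp p) f (t mod int p)"

definition abs_mod :: "int \<Rightarrow> nat \<Rightarrow> int" where
  "abs_mod s m = (INF j. \<bar>s - j * int m\<bar>)"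

text \<open>The infimum is a minimum.\<close>

lemma abs_mod_le: "abs_mod s m \<le> \<bar>s - j * int m\<bar>"
  unfolding abs_mod_def by (rule cINF_lower) (auto intro: bdd_belowI2[where m = 0])

lemma abs_mod_attained: "\<exists>j. abs_mod s m = \<bar>s - j * int m\<bar>"
proof -
  obtain i where i: "\<And>j. nat \<bar>s - i * int m\<bar> \<le> nat \<bar>s - j * int m\<bar>"
    using ex_has_least_nat[of "\<lambda>_. True" _ "\<lambda>j. nat \<bar>s - j * int m\<bar>"] by blast
  have "\<bar>s - i * int m\<bar> \<le> \<bar>s - j * int m\<bar>" for j
    using i[of j] by linarith
  then have "abs_mod s m = \<bar>s - i * int m\<bar>"
    unfolding abs_mod_def by (intro cInf_eq_minimum) auto
  then show ?thesis ..
qed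

definition approx_polys ::
    "nat \<Rightarrow> nat \<Rightarrow> int list \<Rightarrow> real \<Rightarrow> int \<Rightarrow> real \<Rightarrow> int list set" where
  "approx_polys p n f \<rho> h \<Delta> =
     {g \<in> carrier (Fp_poly p). degree g \<le> n \<and>
        \<rho> * real_of_int (2 * h + 1) \<le>
          real (card {t \<in> {-h..h}.
            real_of_int (abs_mod (Fp_eval p g t \<ominus>\<^bsub>Fp p\<^esub> Fp_eval p f t) p) \<le> \<Delta>})}"

text \<open>Finiteness, so that \<open>card\<close> really counts.\<close>

lemma finite_approx_polys: "finite (approx_polys p n f \<rho> h \<Delta>)"
proof (rule finite_subset)
  show "approx_polys p n f \<rho> h \<Delta> \<subseteq> {g. set g \<subseteq> {0..int p - 1} \<and> length g \<le> Suc n}"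
    by (auto simp: approx_polys_def univ_poly_def polynomial_def residue_ring_def)
  show "finite {g. set g \<subseteq> {0..int p - 1} \<and> length g \<le> Suc n}"
    by (rule finite_lists_length_le) simp
qed

end

theory Submission
  imports Defs "HOL-Algebra.Polynomial_Divisibility"
begin

text \<open>Each \<open>g\<close> in the set has at least \<open>\<rho> (2h + 1)\<close> good points \<open>t\<close>. By interpolation, \<open>n + 1\<close>
  given points are good for at most \<open>(2\<Delta> + 1)\<^bsup>n+1\<^esup>\<close> polynomials of degree at most \<open>n\<close>, since
  each value \<open>g(t)\<close> is confined to \<open>2\<Delta> + 1\<close> residues. Counting the pairs of a polynomial and an
  \<open>(n + 1)\<close>-set of its good points in two ways bounds the number of polynomials by
  \<open>O(\<rho>\<^bsup>-(n+1)\<^esup> \<Delta>\<^bsup>n+1\<^esup>)\<close>. Since \<open>\<rho> \<le> 1 \<le> h\<close> and \<open>n + 1 \<le> 2\<^bsup>n-1\<^esup> + n(n\<^sup>2 + 1)/2\<close>,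
  this is stronger than the claim.\<close>

section \<open>Double counting of polynomials against sets of points\<close>

lemma card_mult_binomial_le:
  fixes k a b :: nat
  assumes M: "finite M" and U: "finite U"
    and S: "\<And>g. g \<in> M \<Longrightarrow> S g \<subseteq> U" "\<And>g. g \<in> M \<Longrightarrow> a \<le> card (S g)"
    and fibre: "\<And>T. T \<subseteq> U \<Longrightarrow> card T = k \<Longrightarrow> card {g \<in> M. T \<subseteq> S g} \<le> b"
  shows "card M * (a choose k) \<le> (card U choose k) * b"
proof -
  let ?P = "{T. T \<subseteq> U \<and> card T = k}"
  have P: "finite ?P" using U by simp
  have "a choose k \<le> card {T \<in> ?P. T \<subseteq> S g}" if g: "g \<in> M" for g
  proof -
    have "{T \<in> ?P. T \<subseteq> S g} = {T. T \<subseteq> S g \<and> card T = k}" using S(1)[OF g] by auto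
    moreover have "finite (S g)" using S(1)[OF g] U by (rule finite_subset)
    ultimately show ?thesis using binomial_right_mono[OF S(2)[OF g], of k] by (simp add: n_subsets)
  qed
  then have "card M * (a choose k) \<le> (\<Sum>g\<in>M. card {T \<in> ?P. T \<subseteq> S g})"
    using sum_bounded_below[of M "a choose k"] by simp
  \<comment> \<open>Both sums count the pairs of some \<open>g\<close> in \<open>M\<close> and a
    \<open>k\<close>-subset \<open>T\<close> of \<open>S g\<close>, first by \<open>g\<close> and
    then by \<open>T\<close>.\<close>
  also have "\<dots> = (\<Sum>T\<in>?P. card {g \<in> M. T \<subseteq> S g})"
    using M P by (intro sum_multicount_gen) auto
  also have "\<dots> \<le> card ?P * b"
    using fibre sum_bounded_above[of ?P "\<lambda>T. card {g \<in> M. T \<subseteq> S g}" b] by simp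
  finally show ?thesis using U by (simp add: n_subsets)
qed

section \<open>Uniqueness of interpolation over a field\<close>

text \<open>Otherwise the difference would be a nonzero polynomial of degree at most
  \<open>n\<close> vanishing on all of \<open>A\<close>, which is more roots than its degree
  allows.\<close>

lemma poly_eqI_card:
  fixes R (structure)
  assumes R: "field R" and g: "g1 \<in> carrier (poly_ring R)" "g2 \<in> carrier (poly_ring R)"
    and deg: "degree g1 \<le> n" "degree g2 \<le> n"
    and A: "A \<subseteq> carrier R" "n < card A"
    and eq: "\<And>x. x \<in> A \<Longrightarrow> ring.eval R g1 x = ring.eval R g2 x"
  shows "g1 = g2"
proof (rule ccontr)
  assume neq: "g1 \<noteq> g2"
  interpret field R by (rule R)
  interpret UP: domain "poly_ring R"
    using univ_poly_is_domain[OF carrier_is_subring] .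
  let ?d = "g1 \<ominus>\<^bsub>poly_ring R\<^esub> g2"
  have d: "?d \<in> carrier (poly_ring R)" using g by simp
  have "?d \<noteq> \<zero>\<^bsub>poly_ring R\<^esub>" using neq g by (simp add: UP.r_right_minus_eq)
  then have nz: "?d \<noteq> []" by (simp add: univ_poly_zero)
  have inv_deg: "degree (\<ominus>\<^bsub>poly_ring R\<^esub> g2) \<le> n"
    using deg(2) univ_poly_a_inv_length[OF carrier_is_subring g(2)] by simp
  have "degree ?d \<le> n"
    using poly_add_degree[of g1 "\<ominus>\<^bsub>poly_ring R\<^esub> g2"] deg(1) inv_deg
    unfolding a_minus_def univ_poly_add by linarith
  moreover have "A \<subseteq> set_mset (roots ?d)"
  proof
    fix x assume x: "x \<in> A"
    then have xc: "x \<in> carrier R" using A by auto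
    interpret ev: ring_hom_ring "poly_ring R" R "\<lambda>p. eval p x"
      by (rule eval_ring_hom[OF carrier_is_subring xc])
    have "eval ?d x = eval g1 x \<ominus> eval g2 x"
      using g by (simp add: a_minus_def)
    then have "eval ?d x = \<zero>"
      using eq[OF x] ev.hom_closed[OF g(2)] by (simp add: r_right_minus_eq)
    then show "x \<in># roots ?d"
      using roots_mem_iff_is_root[OF d] xc nz by (simp add: is_root_def)
  qed
  then have "card A \<le> card (set_mset (roots ?d))" by (intro card_mono) auto
  \<comment> \<open>\<open>roots\<close> is a multiset that records multiplicities; each distinct
    root is counted at least once in its size.\<close>
  moreover have "card (set_mset (roots ?d)) \<le> size (roots ?d)"
    unfolding size_multiset_overloaded_eq
    using sum_mono[of "set_mset (roots ?d)" "\<lambda>_. 1" "count (roots ?d)"] by (simp add: Suc_le_eq)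
  ultimately show False using size_roots_le_degree[OF d] A(2) by linarith
qed

section \<open>Residues close to zero modulo p\<close>

lemma finite_abs_mod_le: "finite {s \<in> {0..<int p}. real_of_int (abs_mod s p) \<le> \<Delta>}"
  by (rule finite_subset[of _ "{0..<int p}"]) auto

text \<open>Such residues are reductions of the integers between
  \<open>- \<lfloor>\<Delta>\<rfloor>\<close> and \<open>\<lfloor>\<Delta>\<rfloor>\<close>.
  Reduction need only be onto here, so overlaps modulo \<open>p\<close> do no harm.\<close>

lemma card_abs_mod_le:
  assumes "0 \<le> \<Delta>"
  shows "real (card {s \<in> {0..<int p}. real_of_int (abs_mod s p) \<le> \<Delta>}) \<le> 2 * \<Delta> + 1"
proof -
  let ?R = "{s \<in> {0..<int p}. real_of_int (abs_mod s p) \<le> \<Delta>}"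
  let ?I = "{- \<lfloor>\<Delta>\<rfloor>..\<lfloor>\<Delta>\<rfloor>}"
  have "?R \<subseteq> (\<lambda>u. u mod int p) ` ?I"
  proof
    fix s assume s: "s \<in> ?R"
    obtain j where j: "abs_mod s p = \<bar>s - j * int p\<bar>" using abs_mod_attained by blast
    with s have "real_of_int \<bar>s - j * int p\<bar> \<le> \<Delta>" by simp
    then have "\<bar>s - j * int p\<bar> \<le> \<lfloor>\<Delta>\<rfloor>" by (simp only: le_floor_iff)
    then have "s - j * int p \<in> ?I" by auto
    moreover have "s = (s - j * int p) mod int p"
      using s mod_mult_self1[of s "- j" "int p"] by simp
    ultimately show "s \<in> (\<lambda>u. u mod int p) ` ?I" by (rule rev_image_eqI)
  qed
  then have "card ?R \<le> card ?I" by (rule surj_card_le[rotated]) simp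
  also have "card ?I = nat (2 * \<lfloor>\<Delta>\<rfloor> + 1)" by simp
  finally have "real (card ?R) \<le> 2 * real_of_int \<lfloor>\<Delta>\<rfloor> + 1" using assms by linarith
  then show ?thesis using of_int_floor_le[of \<Delta>] by linarith
qed

section \<open>Polynomials close to f at n + 1 points\<close>

text \<open>Two points of the interval differ by at most \<open>2 * h\<close>, which is below
  \<open>p\<close>. Hence distinct integers \<open>t\<close> are distinct field elements, as
  interpolation requires.\<close>

lemma inj_on_mod_symmetric_interval:
  assumes "2 * h < int p"
  shows "inj_on (\<lambda>t. t mod int p) {-h..h}"
proof (rule inj_onI)
  fix x y assume xy: "x \<in> {-h..h}" "y \<in> {-h..h}" "x mod int p = y mod int p"
  then have "int p dvd x - y" by (simp add: mod_eq_dvd_iff)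
  moreover have "\<bar>x - y\<bar> < \<bar>int p\<bar>" using xy assms by auto
  ultimately show "x = y" using dvd_imp_le_int[of "x - y" "int p"] by fastforce
qed

text \<open>A polynomial \<open>g\<close> is determined by its differences from \<open>f\<close> on
  \<open>T\<close>, and each of these \<open>Suc n\<close> differences is one of at most
  \<open>2 * \<Delta> + 1\<close> residues.\<close>

lemma card_polys_approx_on_le:
  assumes p_prime: "Factorial_Ring.prime p" and h: "2 * h < int p"
    and T: "T \<subseteq> {-h..h}" "card T = Suc n" and \<Delta>: "0 \<le> \<Delta>"
    and f: "f \<in> carrier (Fp_poly p)"
  shows "real (card {g \<in> carrier (Fp_poly p). degree g \<le> n \<and>
      (\<forall>t\<in>T. real_of_int (abs_mod (Fp_eval p g t \<ominus>\<^bsub>Fp p\<^esub> Fp_eval p f t) p) \<le> \<Delta>)})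
    \<le> (2 * \<Delta> + 1) ^ Suc n"
proof -
  define R where "R = Fp p"
  interpret residues_prime p R
    unfolding R_def by unfold_locales (rule p_prime)
  let ?G = "{g \<in> carrier (Fp_poly p). degree g \<le> n \<and>
      (\<forall>t\<in>T. real_of_int (abs_mod (Fp_eval p g t \<ominus>\<^bsub>Fp p\<^esub> Fp_eval p f t) p) \<le> \<Delta>)}"
  let ?V = "{s \<in> {0..<int p}. real_of_int (abs_mod s p) \<le> \<Delta>}"
  \<comment> \<open>Restricting the difference function to \<open>T\<close> makes it extensional, so
    that it lies in a finite \<open>PiE\<close> with a known cardinality.\<close>
  let ?\<phi> = "\<lambda>g. \<lambda>t\<in>T. Fp_eval p g t \<ominus>\<^bsub>R\<^esub> Fp_eval p f t"
  have R_eq: "Fp p = R" by (simp add: R_def)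
  have carrier_R: "carrier R = {0..<int p}" by (auto simp: R_def residue_ring_def)
  have p: "0 < int p" using p_prime prime_gt_0_nat by auto
  have tc: "t mod int p \<in> carrier R" for t using p carrier_R by simp
  have ev: "Fp_eval p g t \<in> carrier R" if "g \<in> carrier (Fp_poly p)" for g t
  proof -
    interpret ev: ring_hom_ring "poly_ring R" R "\<lambda>q. eval q (t mod int p)"
      by (rule eval_ring_hom[OF carrier_is_subring tc])
    show ?thesis using that ev.hom_closed unfolding Fp_eval_def R_eq by simp
  qed
  have fT: "finite T" using T(1) finite_subset by blast
  have "inj_on ?\<phi> ?G"
  proof (rule inj_onI)
    fix g1 g2 assume g: "g1 \<in> ?G" "g2 \<in> ?G" and eq: "?\<phi> g1 = ?\<phi> g2"
    have "eval g1 x = eval g2 x" if x: "x \<in> (\<lambda>t. t mod int p) ` T" for x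
    proof -
      obtain t where t: "t \<in> T" "x = t mod int p" using x by blast
      have "Fp_eval p g1 t \<ominus>\<^bsub>R\<^esub> Fp_eval p f t = Fp_eval p g2 t \<ominus>\<^bsub>R\<^esub> Fp_eval p f t"
        using fun_cong[OF eq, of t] t by simp
      then have "Fp_eval p g1 t = Fp_eval p g2 t"
        using ev[of g1 t] ev[of g2 t] ev[OF f, of t] g unfolding a_minus_def by simp
      then show ?thesis using t unfolding Fp_eval_def R_eq by simp
    qed
    moreover have "card ((\<lambda>t. t mod int p) ` T) = Suc n"
      using T inj_on_subset[OF inj_on_mod_symmetric_interval[OF h]] by (simp add: card_image)
    moreover have "(\<lambda>t. t mod int p) ` T \<subseteq> carrier R" using tc by auto
    ultimately show "g1 = g2"
      using g unfolding R_eq by (intro poly_eqI_card[OF field_axioms, of g1 g2 n "(\<lambda>t. t mod int p) ` T"]) auto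
  qed
  moreover have "?\<phi> ` ?G \<subseteq> PiE T (\<lambda>_. ?V)"
  proof (rule image_subsetI)
    fix g assume g: "g \<in> ?G"
    have "Fp_eval p g t \<ominus>\<^bsub>R\<^esub> Fp_eval p f t \<in> {0..<int p}" for t
      using minus_closed[OF ev[of g t] ev[OF f, of t]] g carrier_R by simp
    with g show "?\<phi> g \<in> PiE T (\<lambda>_. ?V)" unfolding R_eq by auto
  qed
  moreover have "finite (PiE T (\<lambda>_. ?V))" using fT finite_abs_mod_le by (intro finite_PiE) auto
  ultimately have "card ?G \<le> card (PiE T (\<lambda>_. ?V))" by (rule card_inj_on_le)
  also have "\<dots> = card ?V ^ Suc n" using fT T by (simp add: card_PiE)
  finally have "real (card ?G) \<le> real (card ?V) ^ Suc n"
    by (simp only: of_nat_le_iff flip: of_nat_power)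
  also have "\<dots> \<le> (2 * \<Delta> + 1) ^ Suc n"
    by (intro power_mono card_abs_mod_le \<Delta>) simp
  finally show ?thesis .
qed

section \<open>The bound for the whole set\<close>

text \<open>The double count is applied to the \<open>Suc n\<close>-subsets of the interval. With
  \<open>N = 2 * h + 1\<close>, the binomial coefficients are compared with
  \<open>(a / Suc n) ^ Suc n\<close> from below and \<open>N ^ Suc n\<close> from above, and the
  powers of \<open>N\<close> cancel. The last hypothesis gives \<open>Suc n \<le> a\<close>, which
  the lower estimate requires.\<close>

lemma card_approx_polys_le:
  assumes p: "Factorial_Ring.prime p" and h: "1 \<le> h" "2 * h < int p" and \<Delta>: "1 \<le> \<Delta>"
    and f: "f \<in> carrier (Fp_poly p)" and \<rho>: "0 < \<rho>" "real n + 1 \<le> \<rho> * real_of_int (2 * h + 1)"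
  shows "real (card (approx_polys p n f \<rho> h \<Delta>)) \<le> (3 * (real n + 1) * \<Delta> / \<rho>) ^ Suc n"
proof -
  define M where "M = approx_polys p n f \<rho> h \<Delta>"
  define S where "S g = {t \<in> {-h..h}.
      real_of_int (abs_mod (Fp_eval p g t \<ominus>\<^bsub>Fp p\<^esub> Fp_eval p f t) p) \<le> \<Delta>}" for g
  define N where "N = real_of_int (2 * h + 1)"
  define a where "a = nat \<lceil>\<rho> * N\<rceil>"
  define b where "b = nat \<lfloor>(2 * \<Delta> + 1) ^ Suc n\<rfloor>"
  have N: "0 < N" "card {-h..h} = nat (2 * h + 1)" "real (card {-h..h}) = N"
    using h by (auto simp: N_def)
  have a: "\<rho> * N \<le> real a" "Suc n \<le> a"
  proof -
    show "\<rho> * N \<le> real a" unfolding a_def by linarith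
    then show "Suc n \<le> a" using \<rho>(2) unfolding N_def by linarith
  qed
  have count: "card M * (a choose Suc n) \<le> (card {-h..h} choose Suc n) * b"
  proof (rule card_mult_binomial_le)
    show "finite M" unfolding M_def by (rule finite_approx_polys)
    show "a \<le> card (S g)" if "g \<in> M" for g
      using that unfolding M_def approx_polys_def S_def a_def N_def by (auto simp: nat_le_iff ceiling_le_iff)
    fix T assume T: "T \<subseteq> {-h..h}" "card T = Suc n"
    let ?G = "{g \<in> carrier (Fp_poly p). degree g \<le> n \<and>
      (\<forall>t\<in>T. real_of_int (abs_mod (Fp_eval p g t \<ominus>\<^bsub>Fp p\<^esub> Fp_eval p f t) p) \<le> \<Delta>)}"
    have fin: "finite ?G"
    proof (rule finite_subset)
      \<comment> \<open>With density 0 the condition on the number of good points is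
        vacuous.\<close>
      show "?G \<subseteq> approx_polys p n f 0 h \<Delta>" unfolding approx_polys_def by auto
    qed (rule finite_approx_polys)
    have "{g \<in> M. T \<subseteq> S g} \<subseteq> ?G" unfolding M_def S_def approx_polys_def by auto
    then have "card {g \<in> M. T \<subseteq> S g} \<le> card ?G" by (rule card_mono[OF fin])
    also have "card ?G \<le> b"
      using card_polys_approx_on_le[OF p h(2) T _ f, of \<Delta>] \<Delta> unfolding b_def
      by (simp add: le_nat_floor)
    finally show "card {g \<in> M. T \<subseteq> S g} \<le> b" .
  qed (auto simp: S_def)
  have pos: "0 < \<rho> * N / (real n + 1)" using \<rho> N by simp
  have "(\<rho> * N / (real n + 1)) ^ Suc n \<le> (real a / real (Suc n)) ^ Suc n"
    using a(1) pos by (intro power_mono) (auto intro!: divide_right_mono simp: add.commute)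
  also have "\<dots> \<le> real (a choose Suc n)" by (rule binomial_ge_n_over_k_pow_k[OF a(2)])
  finally have "real (card M) * (\<rho> * N / (real n + 1)) ^ Suc n \<le> real (card M * (a choose Suc n))"
    by (simp add: mult_left_mono del: power_Suc)
  also have "\<dots> \<le> real ((card {-h..h} choose Suc n) * b)" using count of_nat_le_iff by blast
  also have "\<dots> \<le> N ^ Suc n * (3 * \<Delta>) ^ Suc n"
  proof -
    have "card {-h..h} choose Suc n \<le> card {-h..h} ^ Suc n"
      by (cases "Suc n \<le> card {-h..h}") (auto simp del: power_Suc intro: binomial_le_pow simp: binomial_eq_0)
    then have 1: "real (card {-h..h} choose Suc n) \<le> N ^ Suc n"
      by (simp only: of_nat_le_iff flip: of_nat_power N(3))
    have "real b \<le> (2 * \<Delta> + 1) ^ Suc n" unfolding b_def using \<Delta> by (intro of_nat_floor) simp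
    \<comment> \<open>The factor 3 absorbs the summand 1, since
      \<open>1 \<le> \<Delta>\<close>.\<close>
    also have "\<dots> \<le> (3 * \<Delta>) ^ Suc n" using \<Delta> by (intro power_mono) auto
    finally show ?thesis using 1 N by (simp add: mult_mono del: power_Suc)
  qed
  finally have "real (card M) \<le> N ^ Suc n * (3 * \<Delta>) ^ Suc n / (\<rho> * N / (real n + 1)) ^ Suc n"
    using pos by (simp add: pos_le_divide_eq del: power_Suc)
  also have "\<dots> = (3 * (real n + 1) * \<Delta> / \<rho>) ^ Suc n"
    unfolding power_mult_distrib[symmetric] power_divide[symmetric]
    using N \<rho> by (intro arg_cong[where f = "\<lambda>x. x ^ Suc n"]) (simp add: field_simps)
  finally show ?thesis unfolding M_def .
qed

section \<open>Comparison with the claimed bound\<close>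

text \<open>The power of 2 contributes at least 1 and the cubic term at least \<open>n\<close>. This
  permits replacing the exponent of \<open>1 / \<rho>\<close> by the larger one claimed.\<close>

lemma Suc_le_exponent:
  assumes "1 \<le> n"
  shows "real (Suc n) \<le> 2 ^ (n - 1) + real n * (real n ^ 2 + 1) / 2"
proof -
  have "1 \<le> real n ^ 2" using assms by simp
  then have "real n * 2 \<le> real n * (real n ^ 2 + 1)" by (intro mult_left_mono) auto
  moreover have "(1::real) \<le> 2 ^ (n - 1)" by simp
  ultimately show ?thesis by (simp only: of_nat_Suc)
qed

text \<open>The lower bound on \<open>\<rho>\<close> yields
  \<open>\<rho> * h \<ge> p powr \<epsilon> \<ge> n + 1\<close>, so there are enough good points for
  the previous count. Its bound is then weakened using
  \<open>\<rho> \<le> 1 \<le> h\<close>.\<close>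

lemma card_approx_polys_le_powr:
  fixes \<epsilon> :: real and n p :: nat and h :: int
  assumes "0 < \<epsilon>" and n: "1 \<le> n"
    and p: "Factorial_Ring.prime p" "real n + 1 \<le> real p powr \<epsilon>" and \<Delta>: "1 \<le> \<Delta>"
    and h: "1 \<le> h" "real_of_int h < real p / 2"
    and f: "f \<in> carrier (Fp_poly p)"
    and \<rho>: "\<rho> \<le> 1" "real_of_int h powr (- (1 / 2 ^ (n - 1))) * real p powr \<epsilon> \<le> \<rho>"
  shows "real (card (approx_polys p n f \<rho> h \<Delta>)) \<le>
         (3 * (real n + 1)) ^ Suc n * (\<rho> powr (- (2 ^ (n - 1)) - real n * (real n ^ 2 + 1) / 2)
              * \<Delta> ^ (n + 1)
              * real_of_int h powr ((real n ^ 2 - real n + 2) / 2))"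
proof -
  define C where "C = (3 * (real n + 1)) ^ Suc n"
  have C: "0 < C" unfolding C_def by simp
  let ?H = "real_of_int h"
  let ?k = "2 ^ (n - 1) + real n * (real n ^ 2 + 1) / 2"
  have H: "1 \<le> ?H" using h by simp
  \<comment> \<open>The exponent \<open>1 / 2 ^ (n - 1)\<close> is at most 1 and the base is at
    least 1.\<close>
  have "?H powr (-1) \<le> ?H powr (- (1 / 2 ^ (n - 1)))"
    using H by (intro powr_mono) auto
  then have "?H powr (-1) * real p powr \<epsilon> \<le> ?H powr (- (1 / 2 ^ (n - 1))) * real p powr \<epsilon>"
    by (intro mult_right_mono) auto
  with \<rho>(2) have "?H powr (-1) * real p powr \<epsilon> \<le> \<rho>" by linarith
  then have \<rho>_ge: "real p powr \<epsilon> \<le> \<rho> * ?H"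
    using H by (simp add: powr_minus divide_simps mult.commute)
  have "0 < \<rho> * ?H" using \<rho>_ge p(2) by linarith
  then have \<rho>_pos: "0 < \<rho>" using H by (simp add: zero_less_mult_iff)
  have "\<rho> * ?H \<le> \<rho> * real_of_int (2 * h + 1)" using \<rho>_pos H by (intro mult_left_mono) auto
  then have many: "real n + 1 \<le> \<rho> * real_of_int (2 * h + 1)" using \<rho>_ge p(2) by linarith
  have "real (card (approx_polys p n f \<rho> h \<Delta>)) \<le> (3 * (real n + 1) * \<Delta> / \<rho>) ^ Suc n"
    using h by (intro card_approx_polys_le p(1) \<Delta> f \<rho>_pos many) linarith+
  also have "\<dots> = C * (\<rho> powr (- real (Suc n)) * \<Delta> ^ (n + 1))"
    unfolding C_def powr_minus powr_realpow[OF \<rho>_pos]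
    by (simp add: power_divide power_mult_distrib divide_inverse power_inverse del: power_Suc)
  also have "\<dots> \<le> C * (\<rho> powr (- ?k) * \<Delta> ^ (n + 1) * ?H powr ((real n ^ 2 - real n + 2) / 2))"
  proof -
    \<comment> \<open>For a base in (0, 1], lowering the exponent increases the power.\<close>
    have "\<rho> powr (- real (Suc n)) \<le> \<rho> powr (- ?k)"
      using Suc_le_exponent[OF n] \<rho>(1) \<rho>_pos by (intro powr_mono') auto
    moreover have "1 \<le> ?H powr ((real n ^ 2 - real n + 2) / 2)"
    proof (rule ge_one_powr_ge_zero[OF H])
      have "real n \<le> real n ^ 2" using n by (simp add: power2_eq_square)
      then show "0 \<le> (real n ^ 2 - real n + 2) / 2" by simp
    qed
    ultimately have "\<rho> powr (- real (Suc n)) * \<Delta> ^ (n + 1) * 1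
        \<le> \<rho> powr (- ?k) * \<Delta> ^ (n + 1) * ?H powr ((real n ^ 2 - real n + 2) / 2)"
      using \<Delta> by (intro mult_mono) auto
    then show ?thesis using C by (simp add: mult_left_mono)
  qed
  finally show ?thesis unfolding C_def by simp
qed

theorem theorem10:
  fixes \<epsilon> :: real and n :: nat
  assumes "\<epsilon> > 0" and "n \<ge> 1"
  shows "\<exists>(C::real) (e :: nat \<Rightarrow> real) (p\<^sub>0::nat).
    C > 0 \<and> e \<longlonglongrightarrow> 0 \<and>
    (\<forall>(p::nat) (h::int) (\<Delta>::real) (f::int list) (\<rho>::real).
       Factorial_Ring.prime p \<longrightarrow> p \<ge> p\<^sub>0 \<longrightarrow>
       \<Delta> \<ge> 1 \<longrightarrow> h \<ge> 1 \<longrightarrow> real_of_int h < real p / 2 \<longrightarrow>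
       real_of_int h ^ (n - 1) \<le> \<Delta> * real p powr (- \<epsilon>) \<longrightarrow>
       \<Delta> < real p powr (1 - \<epsilon>) \<longrightarrow>
       f \<in> carrier (Fp_poly p) \<longrightarrow> degree f \<le> n \<longrightarrow>
       \<rho> \<le> 1 \<longrightarrow>
       \<rho> \<ge> max (\<Delta> / real p) (real_of_int h powr (- (1 / 2 ^ (n - 1)))) * real p powr \<epsilon> \<longrightarrow>
       real (card (approx_polys p n f \<rho> h \<Delta>)) \<le>
         C * (\<rho> powr (- (2 ^ (n - 1)) - real n * (real n ^ 2 + 1) / 2)
              * \<Delta> ^ (n + 1)
              * real_of_int h powr ((real n ^ 2 - real n + 2) / 2)
              * real p powr (e p)))"
proof -
  let ?C = "(3 * (real n + 1)) ^ Suc n"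
  \<comment> \<open>This threshold is what \<open>p powr \<epsilon> \<ge> n + 1\<close> amounts
    to.\<close>
  define p\<^sub>0 where "p\<^sub>0 = nat \<lceil>(real n + 1) powr (1 / \<epsilon>)\<rceil>"
  \<comment> \<open>The count loses no power of \<open>p\<close>, so the zero function serves as
    \<open>e\<close>.\<close>
  show ?thesis
  proof (rule exI[of _ ?C], rule exI[of _ "\<lambda>_. 0"], rule exI[of _ "p\<^sub>0"], intro conjI allI impI)
    fix p :: nat and h :: int and \<Delta> :: real and f :: "int list" and \<rho> :: real
    assume p: "Factorial_Ring.prime p" "p\<^sub>0 \<le> p" and \<Delta>: "1 \<le> \<Delta>"
      and h: "1 \<le> h" "real_of_int h < real p / 2"
      and f: "f \<in> carrier (Fp_poly p)"
      and \<rho>: "\<rho> \<le> 1"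
        "max (\<Delta> / real p) (real_of_int h powr (- (1 / 2 ^ (n - 1)))) * real p powr \<epsilon> \<le> \<rho>"
    have "(real n + 1) powr (1 / \<epsilon>) \<le> real p" using p(2) unfolding p\<^sub>0_def by linarith
    then have "((real n + 1) powr (1 / \<epsilon>)) powr \<epsilon> \<le> real p powr \<epsilon>"
      using assms by (intro powr_mono2) auto
    then have p_eps: "real n + 1 \<le> real p powr \<epsilon>" using assms by (simp add: powr_powr)
    have "real_of_int h powr (- (1 / 2 ^ (n - 1))) * real p powr \<epsilon>
        \<le> max (\<Delta> / real p) (real_of_int h powr (- (1 / 2 ^ (n - 1)))) * real p powr \<epsilon>"
      by (intro mult_right_mono) auto
    then have \<rho>': "real_of_int h powr (- (1 / 2 ^ (n - 1))) * real p powr \<epsilon> \<le> \<rho>"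
      using \<rho>(2) by linarith
    show "real (card (approx_polys p n f \<rho> h \<Delta>)) \<le>
         ?C * (\<rho> powr (- (2 ^ (n - 1)) - real n * (real n ^ 2 + 1) / 2)
              * \<Delta> ^ (n + 1)
              * real_of_int h powr ((real n ^ 2 - real n + 2) / 2)
              * real p powr 0)"
      using card_approx_polys_le_powr[OF assms p(1) p_eps \<Delta> h f \<rho>(1) \<rho>']
        prime_gt_0_nat[OF p(1)] by (simp del: power_Suc)
  qed (auto simp del: power_Suc)
qed

end
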